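(* Let $G=(N,M_0,E,\ell)$ be a bounded, deadlock-free labeled Petri net (LPN) whose $T_u$-induced subnet is acyclic, let $V=(\tilde N,\tilde M_0,E,\tilde\ell)$ be the verifier net of $G$, and let $B=(X,E,f,x_0)$ be the basis reachability graph (BRG) of $V$. Then $G$ is strongly detectable if and only if every state $x=(\tilde M_b,\alpha(\tilde M_b))\in X$ that is reachable in $B$ from (a state of) some cycle of $B$ satisfies $\alpha(\tilde M_b)=0$ and $\tilde M_b=\begin{bmatrix}M_b'\\ M_b\end{bmatrix}$ with $M_b'=M_b$.
   Context: Petri nets. A Petri net is $N=(P,T,Pre,Post)$ with finite sets of places $P$ and transitions $T$ and $Pre,Post:P\times T\to\mathbb N$; $C=Post-Pre$. A marking is a vector $M\in\mathbb N^P$. A transition $t$ is enabled at $M$ if $M\ge Pre(\cdot,t)$, and its firing yields $M+C(\cdot,t)$; $M[\sigma\rangle M'$ means that $\sigma\in T^*$ can be fired from $M$ and yields $M'$. $R(N,M_0)$ is the set of markings reachable from $M_0$, and $L(N,M_0)$ is the set of finite sequences firable from $M_0$. The net with initial marking $M_0$ is bounded if for some $k$, $M(p)\le k$ for all $p\in P$ and $M\in R(N,M_0)$; it is deadlock-free if every reachable marking enables some transition. A net is acyclic if its directed place/transition graph has no oriented cycle. The Parikh vector $\pi(\sigma)$ counts the occurrences of each transition in $\sigma$. LPN. A labeled Petri net is $G=(N,M_0,E,\ell)$ with $\ell:T\to E\cup\{\varepsilon\}$ ($\varepsilon$ the empty word), extended to sequences by concatenation. $T_o=\{t:\ell(t)\in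 E\}$, $T_u=\{t:\ell(t)=\varepsilon\}$. The $T_u$-induced subnet is obtained by deleting all transitions in $T_o$; $C_u$ is its incidence matrix. $\mathcal L(G)=\{\ell(\sigma):\sigma\in L(N,M_0)\}$. For $w\in\mathcal L(G)$, $\mathcal C(w)=\{M:\exists\sigma\in L(N,M_0),\ M_0[\sigma\rangle M,\ \ell(\sigma)=w\}$. $L^\omega(G)$ is the set of infinite transition sequences firable from $M_0$; $\sigma'\preceq\sigma$ means that $\sigma'$ is a finite prefix of $\sigma$. Strong detectability. $G$ is strongly detectable if there is $K\in\mathbb N$ such that for all $\sigma\in L^\omega(G)$ and all $\sigma'\preceq\sigma$, with $w=\ell(\sigma')$: $|w|\ge K\Rightarrow|\mathcal C(w)|=1$. Verifier net (VN). Let $G'=(N',M_0',E,\ell')$ be a place-disjoint copy of $G$ (places $P'$ a disjoint copy of $P$, transitions $T'=T'_o\cup T'_u$ a copy of $T=T_o\cup T_u$, same arcs, labels and initial marking). The VN is the LPN $V=(\tilde N,\tilde M_0,E,\tilde\ell)$, $\tilde N=(\tilde P,\tilde T,\tilde Pre,\tilde Post)$, with $\tilde P=P'\cup P$ and $\tilde M_0=\begin{bmatrix}M_0'\\ M_0\end{bmatrix}$. With $\lambda$ denoting the empty transition, $\tilde T=\tilde T_o\cup\tilde T_u$, where $\tilde T_o=\{(t',t):t'\in T_o',t\in T_o,\ell'(t')=\ell(t)\in E\}$ with $\tilde\ell(t',t)=\ell(t)$, and $\tilde T_u=(T_u'\times\{\lambda\})\cup(\{\lambda\}\times T_u)$ with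 label $\varepsilon$. The arcs of $(t',t)$ restricted to $P'$ are those of $t'$ in $N'$ and restricted to $P$ are those of $t$ in $N$, where $\lambda$ contributes zero arcs. Markings of $V$ are written $\begin{bmatrix}M'\\ M\end{bmatrix}$ with $M'\in\mathbb N^{P'}$, $M\in\mathbb N^{P}$; $M'$ and $M$ are compared via the identification of $P'$ with $P$. $\tilde C,\tilde C_u$ are the incidence matrices of $\tilde N$ and of its $\tilde T_u$-induced subnet. Basis markings. For an LPN with acyclic $T_u$-induced subnet, a marking $M$ and $t\in T_o$, the set of explanations is $\Sigma(M,t)=\{\sigma\in T_u^*: M[\sigma\rangle M',\ M'\ge Pre(\cdot,t)\}$; $\Sigma_{min}(M,t)$ consists of those $\sigma\in\Sigma(M,t)$ for which no $\sigma'\in\Sigma(M,t)$ has $\pi(\sigma')\le\pi(\sigma)$, $\pi(\sigma')\neq\pi(\sigma)$; $Y_{min}(M,t)=\{\pi(\sigma):\sigma\in\Sigma_{min}(M,t)\}\subseteq\mathbb N^{T_u}$. The set of basis markings is the smallest set containing the initial marking and closed under: if $M$ is a basis marking, $t\in T_o$ and $y_u\in Y_{min}(M,t)$, then $M+C(\cdot,t)+C_u y_u$ is a basis marking. $\tilde{\mathcal M}_b$ denotes the set of basis markings of $V$. For $\tilde M_b\in\tilde{\mathcal M}_b$, $\alpha(\tilde M_b)=1$ if there is a nonzero nonnegative integer vector $y_u$ with $\tilde M_b+\tilde C_u y_u\ge0$, and $\alpha(\tilde M_b)=0$ otherwise. BRG of $V$. $B=(X,E,f,x_0)$ is the nondeterministic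 finite automaton with states $X=\{(\tilde M_b,\alpha(\tilde M_b)):\tilde M_b\in\tilde{\mathcal M}_b\}$, initial state $x_0=(\tilde M_0,\alpha(\tilde M_0))$, and an edge labeled $\tilde\ell(\tilde t)$ from $(\tilde M_b,\alpha(\tilde M_b))$ to $(\tilde M_b',\alpha(\tilde M_b'))$ whenever $\tilde t\in\tilde T_o$, $y_u\in Y_{min}(\tilde M_b,\tilde t)$ and $\tilde M_b'=\tilde M_b+\tilde C(\cdot,\tilde t)+\tilde C_u y_u$. A cycle in $B$ is a path $x_{j1}e_{j1}x_{j2}\ldots x_{jk}e_{jk}x_{j1}$ ($k\ge1$) along edges of $B$ with $x_{j1},\dots,x_{jk}$ pairwise distinct. States of a cycle count as reachable from it.
   Formalization: Proved under the added hypothesis that no unobservable transition of G is isolated (without any arcs); as stated the claim fails, e.g. for one marked place with an observable self-loop plus an arc-free unobservable transition, where G is strongly detectable but α=1 on a cycle of B. *)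

theory Defs
  imports Main "HOL-Library.Stream"
begin

text \<open>
  A marking is a vector indexed by the places of a net; it is represented by a function on the
  whole place type that vanishes off the set of places, so that equality of markings is equality
  of functions.
\<close>

type_synonym 'p marking = "'p \<Rightarrow> nat"

record ('p, 't) net =
  places :: "'p set"
  transitions :: "'t set"
  Pre :: "'p \<Rightarrow> 't \<Rightarrow> nat"
  Post :: "'p \<Rightarrow> 't \<Rightarrow> nat"

definition petri_net :: "('p, 't) net \<Rightarrow> bool" where
  "petri_net N \<longleftrightarrow> finite (places N) \<and> finite (transitions N) \<and>
     (\<forall>t\<in>transitions N. \<forall>p. p \<notin> places N \<longrightarrow> Pre N p t = 0 \<and> Post N p t = 0)"

definition incidence :: "('p, 't) net \<Rightarrow> 'p \<Rightarrow> 't \<Rightarrow> int" where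
  "incidence N p t = int (Post N p t) - int (Pre N p t)"

definition enabled :: "('p, 't) net \<Rightarrow> 'p marking \<Rightarrow> 't \<Rightarrow> bool" where
  "enabled N M t \<longleftrightarrow> t \<in> transitions N \<and> (\<forall>p\<in>places N. Pre N p t \<le> M p)"

text \<open>The truncated subtraction is exact whenever \<^term>\<open>t\<close> is enabled at \<^term>\<open>M\<close>.\<close>

definition fire :: "('p, 't) net \<Rightarrow> 'p marking \<Rightarrow> 't \<Rightarrow> 'p marking" where
  "fire N M t = (\<lambda>p. M p + Post N p t - Pre N p t)"

primrec fires :: "('p, 't) net \<Rightarrow> 'p marking \<Rightarrow> 't list \<Rightarrow> 'p marking \<Rightarrow> bool" where
  "fires N M [] M' \<longleftrightarrow> M' = M"
| "fires N M (t # \<sigma>) M' \<longleftrightarrow> enabled N M t \<and> fires N (fire N M t) \<sigma> M'"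

definition reachable :: "('p, 't) net \<Rightarrow> 'p marking \<Rightarrow> 'p marking set" where
  "reachable N M0 = {M. \<exists>\<sigma>. fires N M0 \<sigma> M}"

definition firable :: "('p, 't) net \<Rightarrow> 'p marking \<Rightarrow> 't list set" where
  "firable N M0 = {\<sigma>. \<exists>M. fires N M0 \<sigma> M}"

definition bounded_net :: "('p, 't) net \<Rightarrow> 'p marking \<Rightarrow> bool" where
  "bounded_net N M0 \<longleftrightarrow> (\<exists>k. \<forall>M\<in>reachable N M0. \<forall>p\<in>places N. M p \<le> k)"

definition deadlock_free :: "('p, 't) net \<Rightarrow> 'p marking \<Rightarrow> bool" where
  "deadlock_free N M0 \<longleftrightarrow> (\<forall>M\<in>reachable N M0. \<exists>t. enabled N M t)"

definition flow :: "('p, 't) net \<Rightarrow> ('p + 't) rel" where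
  "flow N =
     {(Inl p, Inr t) |p t. p \<in> places N \<and> t \<in> transitions N \<and> Pre N p t > 0} \<union>
     {(Inr t, Inl p) |p t. p \<in> places N \<and> t \<in> transitions N \<and> Post N p t > 0}"

definition acyclic_net :: "('p, 't) net \<Rightarrow> bool" where
  "acyclic_net N \<longleftrightarrow> acyclic (flow N)"

text \<open>
  An isolated unobservable transition (no input and no output place) is compatible with acyclicity
  of the unobservable subnet and with boundedness. It can be fired arbitrarily often without
  changing the marking, and it forces \<open>\<alpha> = 1\<close> at every basis marking of the verifier net. A strongly
  detectable net with such a transition therefore violates the characterisation as soon as the basis
  reachability graph has a cycle, so these nets have to be excluded.
\<close>

definition isolated_transition :: "('p, 't) net \<Rightarrow> 't \<Rightarrow> bool" where
  "isolated_transition N t \<longleftrightarrow> (\<forall>p\<in>places N. Pre N p t = 0 \<and> Post N p t = 0)"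

definition parikh :: "'t list \<Rightarrow> 't \<Rightarrow> nat" where
  "parikh \<sigma> = (\<lambda>t. count_list \<sigma> t)"


section \<open>Labeled Petri nets\<close>

text \<open>The label \<^term>\<open>None\<close> stands for the empty word.\<close>

record ('p, 't, 'e) lpn =
  net :: "('p, 't) net"
  init :: "'p marking"
  alphabet :: "'e set"
  label :: "'t \<Rightarrow> 'e option"

definition labeled_petri_net :: "('p, 't, 'e) lpn \<Rightarrow> bool" where
  "labeled_petri_net G \<longleftrightarrow> petri_net (net G) \<and>
     (\<forall>p. p \<notin> places (net G) \<longrightarrow> init G p = 0) \<and>
     (\<forall>t\<in>transitions (net G). label G t \<in> Some ` alphabet G \<union> {None})"

definition obs :: "('p, 't, 'e) lpn \<Rightarrow> 't set" where
  "obs G = {t \<in> transitions (net G). label G t \<noteq> None}"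

definition unobs :: "('p, 't, 'e) lpn \<Rightarrow> 't set" where
  "unobs G = {t \<in> transitions (net G). label G t = None}"

definition unobs_subnet :: "('p, 't, 'e) lpn \<Rightarrow> ('p, 't) net" where
  "unobs_subnet G = (net G)\<lparr>transitions := unobs G\<rparr>"

definition word :: "('p, 't, 'e) lpn \<Rightarrow> 't list \<Rightarrow> 'e list" where
  "word G \<sigma> = List.map_filter (label G) \<sigma>"

definition consistent_markings :: "('p, 't, 'e) lpn \<Rightarrow> 'e list \<Rightarrow> 'p marking set" where
  "consistent_markings G w =
     {M. \<exists>\<sigma>\<in>firable (net G) (init G). fires (net G) (init G) \<sigma> M \<and> word G \<sigma> = w}"

definition infinite_firable :: "('p, 't, 'e) lpn \<Rightarrow> 't stream set" where
  "infinite_firable G = {\<sigma>. \<forall>n. stake n \<sigma> \<in> firable (net G) (init G)}"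

definition strongly_detectable :: "('p, 't, 'e) lpn \<Rightarrow> bool" where
  "strongly_detectable G \<longleftrightarrow>
     (\<exists>K. \<forall>\<sigma>\<in>infinite_firable G. \<forall>n.
        let w = word G (stake n \<sigma>) in length w \<ge> K \<longrightarrow> card (consistent_markings G w) = 1)"


section \<open>Verifier net\<close>

text \<open>
  The places of the primed copy are the \<^term>\<open>Inl\<close> copies, those of the original net the
  \<^term>\<open>Inr\<close> copies, so a marking with blocks \<open>M'\<close> and \<open>M\<close> is \<open>case_sum M' M\<close>. A transition is a
  pair whose first component belongs to the primed copy; \<^term>\<open>None\<close> is the empty transition.
\<close>

definition verifier_obs :: "('p, 't, 'e) lpn \<Rightarrow> ('t option \<times> 't option) set" where
  "verifier_obs G = {(Some t', Some t) |t' t. t' \<in> obs G \<and> t \<in> obs G \<and> label G t' = label G t}"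

definition verifier_unobs :: "('p, 't, 'e) lpn \<Rightarrow> ('t option \<times> 't option) set" where
  "verifier_unobs G = (Some ` unobs G) \<times> {None} \<union> {None} \<times> (Some ` unobs G)"

definition verifier_arcs ::
    "('p \<Rightarrow> 't \<Rightarrow> nat) \<Rightarrow> 'p + 'p \<Rightarrow> 't option \<times> 't option \<Rightarrow> nat" where
  "verifier_arcs A q \<tau> =
     (case q of
        Inl p \<Rightarrow> (case fst \<tau> of None \<Rightarrow> 0 | Some t' \<Rightarrow> A p t')
      | Inr p \<Rightarrow> (case snd \<tau> of None \<Rightarrow> 0 | Some t \<Rightarrow> A p t))"

definition verifier_label ::
    "('p, 't, 'e) lpn \<Rightarrow> 't option \<times> 't option \<Rightarrow> 'e option" where
  "verifier_label G \<tau> = (case \<tau> of (Some t', Some t) \<Rightarrow> label G t | _ \<Rightarrow> None)"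

definition verifier :: "('p, 't, 'e) lpn \<Rightarrow> ('p + 'p, 't option \<times> 't option, 'e) lpn" where
  "verifier G =
     \<lparr>net =
        \<lparr>places = places (net G) <+> places (net G),
         transitions = verifier_obs G \<union> verifier_unobs G,
         Pre = verifier_arcs (Pre (net G)),
         Post = verifier_arcs (Post (net G))\<rparr>,
      init = case_sum (init G) (init G),
      alphabet = alphabet G,
      label = verifier_label G\<rparr>"


section \<open>Basis markings and the basis reachability graph\<close>

definition explanations :: "('p, 't, 'e) lpn \<Rightarrow> 'p marking \<Rightarrow> 't \<Rightarrow> 't list set" where
  "explanations G M t =
     {\<sigma>. set \<sigma> \<subseteq> unobs G \<and> (\<exists>M'. fires (net G) M \<sigma> M' \<and> enabled (net G) M' t)}"

definition min_explanations :: "('p, 't, 'e) lpn \<Rightarrow> 'p marking \<Rightarrow> 't \<Rightarrow> 't list set" where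
  "min_explanations G M t =
     {\<sigma> \<in> explanations G M t.
        \<not> (\<exists>\<sigma>'\<in>explanations G M t. parikh \<sigma>' \<le> parikh \<sigma> \<and> parikh \<sigma>' \<noteq> parikh \<sigma>)}"

definition Ymin :: "('p, 't, 'e) lpn \<Rightarrow> 'p marking \<Rightarrow> 't \<Rightarrow> ('t \<Rightarrow> nat) set" where
  "Ymin G M t = parikh ` min_explanations G M t"

text \<open>The \<open>p\<close>-component of \<open>C\<^sub>u y\<close>; only the entries of \<open>y\<close> on unobservable transitions matter.\<close>

definition unobs_effect :: "('p, 't, 'e) lpn \<Rightarrow> ('t \<Rightarrow> nat) \<Rightarrow> 'p \<Rightarrow> int" where
  "unobs_effect G y p = (\<Sum>t\<in>unobs G. incidence (unobs_subnet G) p t * int (y t))"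

definition basis_step ::
    "('p, 't, 'e) lpn \<Rightarrow> 'p marking \<Rightarrow> 't \<Rightarrow> ('t \<Rightarrow> nat) \<Rightarrow> 'p marking \<Rightarrow> bool" where
  "basis_step G M t y M' \<longleftrightarrow> t \<in> obs G \<and> y \<in> Ymin G M t \<and>
     (\<forall>p. int (M' p) = int (M p) + incidence (net G) p t + unobs_effect G y p)"

inductive_set basis_markings :: "('p, 't, 'e) lpn \<Rightarrow> 'p marking set"
  for G :: "('p, 't, 'e) lpn" where
  initial: "init G \<in> basis_markings G"
| step: "M \<in> basis_markings G \<Longrightarrow> basis_step G M t y M' \<Longrightarrow> M' \<in> basis_markings G"

definition alpha :: "('p, 't, 'e) lpn \<Rightarrow> 'p marking \<Rightarrow> nat" where
  "alpha G M =
     (if \<exists>y :: 't \<Rightarrow> nat. (\<exists>t\<in>unobs G. y t \<noteq> 0) \<and>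
           (\<forall>p\<in>places (net G). int (M p) + unobs_effect G y p \<ge> 0)
      then 1 else 0)"

record ('q, 'e) nfa =
  nfa_states :: "'q set"
  nfa_alphabet :: "'e set"
  nfa_edges :: "('q \<times> 'e \<times> 'q) set"
  nfa_init :: 'q

definition brg :: "('p, 't, 'e) lpn \<Rightarrow> ('p marking \<times> nat, 'e) nfa" where
  "brg G =
     \<lparr>nfa_states = {(M, alpha G M) |M. M \<in> basis_markings G},
      nfa_alphabet = alphabet G,
      nfa_edges = {((M, alpha G M), e, (M', alpha G M')) |M e M'.
        M \<in> basis_markings G \<and> (\<exists>t y. basis_step G M t y M' \<and> label G t = Some e)},
      nfa_init = (init G, alpha G (init G))\<rparr>"

text \<open>The cycle visits the states \<open>xs\<close> in order, the last edge leading back to the first state.\<close>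

definition nfa_cycle :: "('q, 'e) nfa \<Rightarrow> 'q list \<Rightarrow> 'e list \<Rightarrow> bool" where
  "nfa_cycle B xs es \<longleftrightarrow> xs \<noteq> [] \<and> length es = length xs \<and> distinct xs \<and>
     (\<forall>i<length xs. (xs ! i, es ! i, xs ! (Suc i mod length xs)) \<in> nfa_edges B)"

definition nfa_step :: "('q, 'e) nfa \<Rightarrow> 'q rel" where
  "nfa_step B = {(x, x'). \<exists>e. (x, e, x') \<in> nfa_edges B}"

definition reachable_from_cycle :: "('q, 'e) nfa \<Rightarrow> 'q \<Rightarrow> bool" where
  "reachable_from_cycle B x \<longleftrightarrow>
     (\<exists>xs es. nfa_cycle B xs es \<and> (\<exists>z\<in>set xs. (z, x) \<in> (nfa_step B)\<^sup>*))"

end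

theory Submission
  imports Defs
begin

text \<open>
  A path of length \<open>n\<close> in the basis reachability graph of the verifier net stands for two firing
  sequences of the net with a common word of length \<open>n\<close>, and conversely two such sequences lead, up
  to unobservable firings of the verifier net, to a basis marking at the end of such a path. As the
  graph is finite, every sufficiently long path ends in a state reachable from a cycle, and every
  state reachable from a cycle is the end of arbitrarily long paths. Acyclicity of the unobservable subnet makes \<open>\<alpha> = 1\<close> equivalent to some
  unobservable transition being enabled. Firing one changes the marking but not the word, so
  detectability forces \<open>\<alpha> = 0\<close>; and \<open>\<alpha> = 0\<close> means that every marking pair explained by a basis
  marking is that basis marking itself.
\<close>

section \<open>Firing sequences, their words and the firing equation\<close>

lemma fires_append:
  "fires N M (\<sigma> @ \<tau>) M' \<longleftrightarrow> (\<exists>M1. fires N M \<sigma> M1 \<and> fires N M1 \<tau> M')"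
  by (induction \<sigma> arbitrary: M) auto

lemma word_Nil [simp]: "word G [] = []"
  by (simp add: word_def List.map_filter_def)

lemma word_Cons:
  "word G (t # \<sigma>) = (case label G t of None \<Rightarrow> word G \<sigma> | Some e \<Rightarrow> e # word G \<sigma>)"
  by (simp add: word_def List.map_filter_def split: option.split)

lemma word_append: "word G (\<sigma> @ \<tau>) = word G \<sigma> @ word G \<tau>"
  by (simp add: word_def List.map_filter_def)

lemma word_unobs: "set \<sigma> \<subseteq> unobs G \<Longrightarrow> word G \<sigma> = []"
  by (induction \<sigma>) (auto simp: word_Cons unobs_def)

lemma fire_eq:
  assumes "petri_net N" "enabled N M t"
  shows "int (fire N M t p) = int (M p) + incidence N p t"
  using assms unfolding petri_net_def enabled_def fire_def incidence_def
  by (cases "p \<in> places N") (force simp: of_nat_diff)+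

lemma fire_eqI:
  assumes "petri_net N" "enabled N M t" "\<And>p. int (M' p) = int (M p) + incidence N p t"
  shows "fire N M t = M'"
proof
  fix p
  show "fire N M t p = M' p"
    using fire_eq[OF assms(1,2), of p] assms(3)[of p] by simp
qed


section \<open>Unobservable firings\<close>

lemma finite_unobs: "petri_net (net G) \<Longrightarrow> finite (unobs G)"
  by (auto simp: petri_net_def unobs_def)

lemma unobs_effect_zero: "\<forall>t\<in>unobs G. y t = 0 \<Longrightarrow> unobs_effect G y p = 0"
  by (simp add: unobs_effect_def)

lemma unobs_effect_add:
  "unobs_effect G (\<lambda>t. y t + z t) p = unobs_effect G y p + unobs_effect G z p"
  by (simp add: unobs_effect_def sum.distrib distrib_left)

lemma unobs_effect_single:
  assumes "petri_net (net G)" "t \<in> unobs G"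
  shows "unobs_effect G (\<lambda>u. if u = t then 1 else 0) p = incidence (net G) p t"
proof -
  have "unobs_effect G (\<lambda>u. if u = t then 1 else 0) p
      = (\<Sum>u\<in>unobs G. if u = t then incidence (net G) p u else 0)"
    unfolding unobs_effect_def
    by (rule sum.cong) (auto simp: incidence_def unobs_subnet_def)
  then show ?thesis
    using assms finite_unobs[OF assms(1)] by simp
qed

lemma parikh_Cons: "parikh (t # \<sigma>) = (\<lambda>u. parikh \<sigma> u + (if u = t then 1 else 0))"
  by (auto simp: parikh_def)

lemma unobs_effect_parikh_Cons:
  assumes "petri_net (net G)" "t \<in> unobs G"
  shows "unobs_effect G (parikh (t # \<sigma>)) p
      = unobs_effect G (parikh \<sigma>) p + incidence (net G) p t"
  unfolding parikh_Cons unobs_effect_add unobs_effect_single[OF assms] ..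

lemma fires_unobs_effect:
  assumes "petri_net (net G)" "fires (net G) M \<sigma> M'" "set \<sigma> \<subseteq> unobs G"
  shows "int (M' p) = int (M p) + unobs_effect G (parikh \<sigma>) p"
  using assms(2,3)
proof (induction \<sigma> arbitrary: M)
  case Nil
  then show ?case by (simp add: parikh_def unobs_effect_def)
next
  case (Cons t \<sigma>)
  then show ?case
    using Cons.IH[of "fire (net G) M t"] fire_eq[OF assms(1), of M t p]
      unobs_effect_parikh_Cons[OF assms(1), of t \<sigma> p] by simp
qed

lemma finite_flow: "petri_net N \<Longrightarrow> finite (flow N)"
  by (rule finite_subset[where B = "(Inl ` places N \<union> Inr ` transitions N) \<times>
      (Inl ` places N \<union> Inr ` transitions N)"])
    (auto simp: flow_def petri_net_def)

lemma petri_net_unobs_subnet: "petri_net (net G) \<Longrightarrow> petri_net (unobs_subnet G)"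
  by (auto simp: petri_net_def unobs_subnet_def unobs_def)

text \<open>A place that is both input and output of \<open>t\<close> would close a flow cycle of
  length two. Consequently no effect of an unobservable transition is cancelled inside its incidence
  column.\<close>

lemma unobs_no_self_loop:
  assumes "acyclic_net (unobs_subnet G)" "t \<in> unobs G" "p \<in> places (net G)"
    "Pre (net G) p t > 0"
  shows "Post (net G) p t = 0"
proof (rule ccontr)
  assume "Post (net G) p t \<noteq> 0"
  then have "(Inr t, Inl p) \<in> flow (unobs_subnet G)" "(Inl p, Inr t) \<in> flow (unobs_subnet G)"
    using assms by (auto simp: flow_def unobs_subnet_def)
  then have "(Inr t, Inr t) \<in> (flow (unobs_subnet G))\<^sup>+"
    by (meson r_into_trancl' trancl_trans)
  then show False
    using assms(1) by (auto simp: acyclic_net_def acyclic_def)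
qed

text \<open>
  A transition of the support that is minimal in the flow order receives no tokens from the other
  transitions of the support, so the current marking alone must cover its input places.
\<close>

lemma enabled_in_support:
  fixes G :: "('a, 'b, 'c) lpn"
  assumes pn: "petri_net (net G)" and ac: "acyclic_net (unobs_subnet G)"
    and nonneg: "\<forall>p\<in>places (net G). int (M p) + unobs_effect G y p \<ge> 0"
    and nz: "\<exists>t\<in>unobs G. y t \<noteq> 0"
  shows "\<exists>t\<in>unobs G. y t \<noteq> 0 \<and> enabled (net G) M t"
proof -
  let ?S = "{t \<in> unobs G. y t \<noteq> 0}"
  let ?F = "flow (unobs_subnet G)"
  have wf: "wf (?F\<^sup>+)"
    using finite_acyclic_wf[OF finite_flow[OF petri_net_unobs_subnet[OF pn]]] ac
    by (simp add: acyclic_net_def wf_trancl)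
  from nz obtain t0 where mem: "(Inr t0 :: 'a + 'b) \<in> Inr ` ?S" by auto
  have "\<exists>z\<in>Inr ` ?S. \<forall>x. (x, z) \<in> ?F\<^sup>+ \<longrightarrow> x \<notin> Inr ` ?S"
    by (rule wf[unfolded wf_eq_minimal, rule_format, OF mem])
  then obtain z where z: "z \<in> Inr ` ?S" "\<forall>x. (x, z) \<in> ?F\<^sup>+ \<longrightarrow> x \<notin> Inr ` ?S"
    by (rule bexE)
  from z(1) obtain t where t: "t \<in> unobs G" "y t \<noteq> 0" "z = Inr t" by auto
  have "Pre (net G) p t \<le> M p" if p: "p \<in> places (net G)" for p
  proof (cases "Pre (net G) p t > 0")
    case True
    \<comment> \<open>The case \<open>s = t\<close> is included: a self-loop would put
      \<open>z\<close> below itself in the flow order.\<close>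
    have no_input: "Post (net G) p s = 0" if s: "s \<in> ?S" for s
    proof (rule ccontr)
      assume "Post (net G) p s \<noteq> 0"
      then have "(Inr s, Inl p) \<in> ?F" "(Inl p, Inr t) \<in> ?F"
        using s p t True by (auto simp: flow_def unobs_subnet_def)
      then have "(Inr s, z) \<in> ?F\<^sup>+"
        unfolding t(3) by (meson r_into_trancl' trancl_trans)
      then show False using z(2) s by blast
    qed
    let ?f = "\<lambda>s. incidence (unobs_subnet G) p s * int (y s)"
    \<comment> \<open>Transitions off the support contribute zero, and those in it can only consume
      from \<open>p\<close>.\<close>
    have "?f s \<le> 0" if "s \<in> unobs G" for s
      using no_input[of s] that
      by (cases "y s = 0") (auto simp: incidence_def unobs_subnet_def)
    then have "sum ?f (unobs G - {t}) \<le> 0"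
      by (intro sum_nonpos) auto
    moreover have "unobs_effect G y p = ?f t + sum ?f (unobs G - {t})"
      unfolding unobs_effect_def using finite_unobs[OF pn] t(1) by (rule sum.remove)
    \<comment> \<open>The tokens in \<open>M p\<close> must pay for all \<open>y t\<close> firings
      of \<open>t\<close>, and \<open>y t\<close> is at least one, so they pay for a single
      firing.\<close>
    moreover have "?f t = - (int (Pre (net G) p t) * int (y t))"
      using no_input[of t] t by (simp add: incidence_def unobs_subnet_def)
    moreover have "int (Pre (net G) p t) * 1 \<le> int (Pre (net G) p t) * int (y t)"
      using t(2) by (intro mult_left_mono) auto
    ultimately show ?thesis using nonneg p by fastforce
  qed simp
  then have "enabled (net G) M t"
    using t(1) by (auto simp: enabled_def unobs_def)
  then show ?thesis using t by blast
qed

text \<open>In an acyclic subnet the state equation suffices for reachability: some transition of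
  the support is enabled, firing it lowers \<open>y\<close> by a unit vector, and the rest follows
  by induction on the total of \<open>y\<close>.\<close>

lemma state_equation_realizable:
  assumes pn: "petri_net (net G)" and ac: "acyclic_net (unobs_subnet G)"
    and "\<And>p. int (M' p) = int (M p) + unobs_effect G y p"
  shows "\<exists>\<sigma>. set \<sigma> \<subseteq> unobs G \<and> fires (net G) M \<sigma> M'"
  using assms(3)
proof (induction "sum y (unobs G)" arbitrary: y M rule: less_induct)
  case less
  show ?case
  proof (cases "\<exists>t\<in>unobs G. y t \<noteq> 0")
    case False
    then have "M' p = M p" for p
      using less.prems[of p] unobs_effect_zero[of G y p] by auto
    then have "M' = M" by auto
    then show ?thesis by (intro exI[of _ "[]"]) simp
  next
    case True
    \<comment> \<open>The left-hand side is the natural number \<open>M' p\<close>.\<close>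
    have "\<forall>p\<in>places (net G). int (M p) + unobs_effect G y p \<ge> 0"
      using less.prems by (metis of_nat_0_le_iff)
    with True obtain t where t: "t \<in> unobs G" "y t \<noteq> 0" "enabled (net G) M t"
      using enabled_in_support[OF pn ac] by blast
    let ?z = "y(t := y t - 1)"
    have y: "y = (\<lambda>u. ?z u + (if u = t then 1 else 0))"
      using t(2) by auto
    have eff: "unobs_effect G y p = unobs_effect G ?z p + incidence (net G) p t" for p
      unfolding unobs_effect_single[OF pn t(1), symmetric]
      by (subst y) (rule unobs_effect_add)
    have "sum ?z (unobs G) < sum y (unobs G)"
      using t by (intro sum_strict_mono_ex1 finite_unobs pn) auto
    moreover have "int (M' p) = int (fire (net G) M t p) + unobs_effect G ?z p" for p
      using less.prems[of p] eff[of p] fire_eq[OF pn t(3), of p] by simp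
    ultimately obtain \<sigma> where "set \<sigma> \<subseteq> unobs G" "fires (net G) (fire (net G) M t) \<sigma> M'"
      using less.hyps[of ?z "fire (net G) M t"] by blast
    then show ?thesis
      using t by (intro exI[of _ "t # \<sigma>"]) simp
  qed
qed

lemma alpha_cases: "alpha G M = 0 \<or> alpha G M = 1"
  by (simp add: alpha_def)

text \<open>A nonzero solution of the state inequality has an enabled transition in its support;
  conversely an enabled transition yields its unit vector as a solution. This turns
  \<open>alpha\<close> into a one-step firing condition.\<close>

lemma alpha_eq_1_iff:
  assumes pn: "petri_net (net G)" and ac: "acyclic_net (unobs_subnet G)"
  shows "alpha G M = 1 \<longleftrightarrow> (\<exists>t\<in>unobs G. enabled (net G) M t)"
proof
  assume "alpha G M = 1"
  then obtain y where "\<exists>t\<in>unobs G. y t \<noteq> 0"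
    "\<forall>p\<in>places (net G). int (M p) + unobs_effect G y p \<ge> 0"
    by (auto simp: alpha_def split: if_splits)
  then show "\<exists>t\<in>unobs G. enabled (net G) M t"
    using enabled_in_support[OF pn ac] by blast
next
  assume "\<exists>t\<in>unobs G. enabled (net G) M t"
  then obtain t where t: "t \<in> unobs G" "enabled (net G) M t" by blast
  let ?y = "\<lambda>u. if u = t then 1 else 0 :: nat"
  have "int (M p) + unobs_effect G ?y p \<ge> 0" for p
    unfolding unobs_effect_single[OF pn t(1)] fire_eq[OF pn t(2), symmetric] by simp
  moreover have "\<exists>t\<in>unobs G. ?y t \<noteq> 0" using t(1) by auto
  ultimately have "\<exists>y. (\<exists>t\<in>unobs G. y t \<noteq> 0) \<and>
      (\<forall>p\<in>places (net G). int (M p) + unobs_effect G y p \<ge> 0)"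
    by (intro exI[of _ ?y] conjI) auto
  then show "alpha G M = 1"
    unfolding alpha_def by (rule if_P)
qed


section \<open>Basis markings\<close>

text \<open>Makes length a measure for descending to minimal explanations, because the length is the
  total of the Parikh vector.\<close>

lemma length_less_of_parikh_less:
  assumes "parikh \<sigma>' \<le> parikh \<sigma>" "parikh \<sigma>' \<noteq> parikh \<sigma>"
  shows "length \<sigma>' < length \<sigma>"
proof -
  have le: "count_list \<sigma>' t \<le> count_list \<sigma> t" for t
    using assms(1) by (simp add: le_fun_def parikh_def)
  have sub: "set \<sigma>' \<subseteq> set \<sigma>"
    using le by (metis count_list_0_iff le_zero_eq subsetI)
  obtain t where "count_list \<sigma>' t \<noteq> count_list \<sigma> t"
    using assms(2) by (auto simp: parikh_def)
  with le[of t] have t: "count_list \<sigma>' t < count_list \<sigma> t" by simp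
  then have "t \<in> set \<sigma>" by (metis count_list_0_iff not_less_zero)
  \<comment> \<open>Summing over \<open>set \<sigma>\<close> gives both lengths, since it contains
    \<open>set \<sigma>'\<close>.\<close>
  then have "(\<Sum>u\<in>set \<sigma>. count_list \<sigma>' u) < (\<Sum>u\<in>set \<sigma>. count_list \<sigma> u)"
    using t le by (intro sum_strict_mono_ex1) auto
  moreover have "(\<Sum>u\<in>set \<sigma>. count_list \<sigma>' u) = length \<sigma>'"
    using sub by (metis List.finite_set sum_count_set)
  ultimately show ?thesis by (simp add: sum_count_set)
qed

text \<open>A shortest explanation among those with Parikh vector below that of
  \<open>\<sigma>\<close> is minimal among all explanations, since anything strictly below it would
  be shorter and still below \<open>\<sigma>\<close>.\<close>

lemma min_explanation_below:
  assumes "\<sigma> \<in> explanations G M t"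
  shows "\<exists>\<sigma>'\<in>min_explanations G M t. parikh \<sigma>' \<le> parikh \<sigma>"
proof -
  let ?P = "\<lambda>\<sigma>'. \<sigma>' \<in> explanations G M t \<and> parikh \<sigma>' \<le> parikh \<sigma>"
  have "?P \<sigma>" using assms by simp
  then obtain \<sigma>' where min: "?P \<sigma>'" "\<And>\<rho>. ?P \<rho> \<Longrightarrow> length \<sigma>' \<le> length \<rho>"
    using ex_has_least_nat[of ?P \<sigma> length] by blast
  have "\<not> (parikh \<rho> \<le> parikh \<sigma>' \<and> parikh \<rho> \<noteq> parikh \<sigma>')" if "\<rho> \<in> explanations G M t" for \<rho>
    using that min length_less_of_parikh_less[of \<rho> \<sigma>'] order_trans[of "parikh \<rho>" "parikh \<sigma>'"]
    by (meson not_le)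
  then have "\<sigma>' \<in> min_explanations G M t"
    using min(1) by (auto simp: min_explanations_def)
  with min(1) show ?thesis by blast
qed

lemma basis_step_of_min_explanation:
  assumes pn: "petri_net (net G)" and t: "t \<in> obs G"
    and \<sigma>: "\<sigma> \<in> min_explanations G M t" "fires (net G) M \<sigma> M1"
  shows "basis_step G M t (parikh \<sigma>) (fire (net G) M1 t)"
proof -
  obtain M2 where "set \<sigma> \<subseteq> unobs G" "fires (net G) M \<sigma> M2" "enabled (net G) M2 t"
    using \<sigma>(1) by (auto simp: min_explanations_def explanations_def)
  \<comment> \<open>Firing is deterministic, so the marking in the definition of explanations is the
    given one.\<close>
  moreover have "M2 = M1"
    using calculation(2) \<sigma>(2) by (induction \<sigma> arbitrary: M) auto
  ultimately have "set \<sigma> \<subseteq> unobs G" "enabled (net G) M1 t" by auto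
  then show ?thesis
    using t \<sigma> fire_eq[OF pn, of M1 t] fires_unobs_effect[OF pn \<sigma>(2)]
    by (auto simp: basis_step_def Ymin_def)
qed

lemma basis_step_fires:
  assumes pn: "petri_net (net G)" and "basis_step G M t y M'"
  shows "\<exists>\<sigma>. set \<sigma> \<subseteq> unobs G \<and> fires (net G) M (\<sigma> @ [t]) M'"
proof -
  obtain \<sigma> M1 where \<sigma>: "y = parikh \<sigma>" "set \<sigma> \<subseteq> unobs G" "fires (net G) M \<sigma> M1"
      "enabled (net G) M1 t"
    using assms(2) by (auto simp: basis_step_def Ymin_def min_explanations_def explanations_def)
  have "fire (net G) M1 t = M'"
    using assms(2) \<sigma>(1) fires_unobs_effect[OF pn \<sigma>(3,2)]
    by (intro fire_eqI[OF pn \<sigma>(4)]) (simp add: basis_step_def)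
  with \<sigma> show ?thesis by (auto simp: fires_append)
qed

text \<open>Unobservable firings that \<open>t\<close> does not need can be postponed until after
  \<open>t\<close>. A minimal explanation \<open>\<tau>\<close> below \<open>\<sigma>\<close> gives
  the basis step; the remaining vector satisfies the state equation between the two results, and
  acyclicity makes it firable.\<close>

lemma unobs_then_obs_basis_step:
  assumes pn: "petri_net (net G)" and ac: "acyclic_net (unobs_subnet G)"
    and t: "t \<in> obs G" and \<sigma>: "set \<sigma> \<subseteq> unobs G"
    and f: "fires (net G) Mb \<sigma> M" "enabled (net G) M t"
  shows "\<exists>y Mb' \<rho>. basis_step G Mb t y Mb' \<and> set \<rho> \<subseteq> unobs G \<and>
    fires (net G) Mb' \<rho> (fire (net G) M t)"
proof -
  have "\<sigma> \<in> explanations G Mb t"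
    using \<sigma> f by (auto simp: explanations_def)
  then obtain \<tau> where \<tau>: "\<tau> \<in> min_explanations G Mb t" "parikh \<tau> \<le> parikh \<sigma>"
    using min_explanation_below[of \<sigma> G Mb t] by blast
  then obtain M1 where M1: "set \<tau> \<subseteq> unobs G" "fires (net G) Mb \<tau> M1" "enabled (net G) M1 t"
    by (auto simp: min_explanations_def explanations_def)
  let ?z = "\<lambda>u. parikh \<sigma> u - parikh \<tau> u"
  \<comment> \<open>The truncated subtraction in \<open>?z\<close> is exact because
    \<open>\<tau>\<close> lies below \<open>\<sigma>\<close>.\<close>
  have eq: "parikh \<sigma> = (\<lambda>u. ?z u + parikh \<tau> u)"
    using \<tau>(2) by (auto simp: le_fun_def)
  have "unobs_effect G (parikh \<sigma>) p = unobs_effect G ?z p + unobs_effect G (parikh \<tau>) p" for p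
    by (subst eq) (rule unobs_effect_add)
  then have "int (fire (net G) M t p) = int (fire (net G) M1 t p) + unobs_effect G ?z p" for p
    using fires_unobs_effect[OF pn f(1) \<sigma>] fires_unobs_effect[OF pn M1(2,1)]
      fire_eq[OF pn f(2)] fire_eq[OF pn M1(3)] by simp
  then obtain \<rho> where "set \<rho> \<subseteq> unobs G" "fires (net G) (fire (net G) M1 t) \<rho> (fire (net G) M t)"
    using state_equation_realizable[OF pn ac] by blast
  with basis_step_of_min_explanation[OF pn t \<tau>(1) M1(2)] show ?thesis by blast
qed

section \<open>Paths of the basis reachability graph versus firing sequences\<close>

abbreviation (input) brg_state :: "('p, 't, 'e) lpn \<Rightarrow> 'p marking \<Rightarrow> 'p marking \<times> nat" where
  "brg_state G M \<equiv> (M, alpha G M)"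

lemma nfa_step_brg:
  "(x, x') \<in> nfa_step (brg G) \<longleftrightarrow> (\<exists>M M' t y e. x = brg_state G M \<and> x' = brg_state G M' \<and>
     M \<in> basis_markings G \<and> basis_step G M t y M' \<and> label G t = Some e)"
  by (simp add: nfa_step_def brg_def) blast

lemma basis_step_nfa_step:
  "M \<in> basis_markings G \<Longrightarrow> basis_step G M t y M' \<Longrightarrow>
    (brg_state G M, brg_state G M') \<in> nfa_step (brg G)"
  by (force simp: nfa_step_brg basis_step_def obs_def)

lemma fires_basis_path:
  assumes pn: "petri_net (net G)" and ac: "acyclic_net (unobs_subnet G)"
    and "fires (net G) (init G) \<sigma> M"
  shows "\<exists>Mb \<rho>. Mb \<in> basis_markings G \<and> set \<rho> \<subseteq> unobs G \<and> fires (net G) Mb \<rho> M \<and>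
    (brg_state G (init G), brg_state G Mb) \<in> nfa_step (brg G) ^^ length (word G \<sigma>)"
  using assms(3)
proof (induction \<sigma> arbitrary: M rule: rev_induct)
  case Nil
  then show ?case
    by (intro exI[of _ "init G"] exI[of _ "[]"]) (auto intro: basis_markings.initial)
next
  case (snoc t \<sigma>)
  then obtain M1 where M1: "fires (net G) (init G) \<sigma> M1" "enabled (net G) M1 t"
      "M = fire (net G) M1 t"
    by (auto simp: fires_append)
  obtain Mb \<rho> where IH: "Mb \<in> basis_markings G" "set \<rho> \<subseteq> unobs G" "fires (net G) Mb \<rho> M1"
      "(brg_state G (init G), brg_state G Mb) \<in> nfa_step (brg G) ^^ length (word G \<sigma>)"
    using snoc.IH[OF M1(1)] by blast
  show ?case
  proof (cases "label G t")
    case None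
    then have "set (\<rho> @ [t]) \<subseteq> unobs G"
      using IH M1 by (auto simp: unobs_def enabled_def)
    moreover have "fires (net G) Mb (\<rho> @ [t]) M"
      using IH M1 by (auto simp: fires_append)
    moreover have "word G (\<sigma> @ [t]) = word G \<sigma>"
      using None by (simp add: word_append word_Cons)
    ultimately show ?thesis using IH by metis
  next
    case (Some e)
    then have "t \<in> obs G"
      using M1 by (auto simp: obs_def enabled_def)
    then obtain y Mb' \<rho>' where s: "basis_step G Mb t y Mb'" "set \<rho>' \<subseteq> unobs G"
        "fires (net G) Mb' \<rho>' M"
      using unobs_then_obs_basis_step[OF pn ac _ IH(2,3) M1(2)] M1(3) by blast
    have "(brg_state G (init G), brg_state G Mb') \<in> nfa_step (brg G) ^^ Suc (length (word G \<sigma>))"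
      using IH(4) basis_step_nfa_step[OF IH(1) s(1)] by auto
    moreover have "Mb' \<in> basis_markings G"
      using IH(1) s(1) by (rule basis_markings.step)
    moreover have "length (word G (\<sigma> @ [t])) = Suc (length (word G \<sigma>))"
      using Some by (simp add: word_append word_Cons)
    ultimately show ?thesis using s by metis
  qed
qed

text \<open>Each edge unfolds into an explanation followed by its observable transition and thus
  contributes exactly one letter.\<close>

lemma basis_path_fires:
  assumes pn: "petri_net (net G)"
    and "(brg_state G (init G), x) \<in> nfa_step (brg G) ^^ n"
  shows "\<exists>\<sigma>. fires (net G) (init G) \<sigma> (fst x) \<and> length (word G \<sigma>) = n"
  using assms(2)
proof (induction n arbitrary: x)
  case 0
  then show ?case by (intro exI[of _ "[]"]) auto
next
  case (Suc n)
  then obtain z where z: "(brg_state G (init G), z) \<in> nfa_step (brg G) ^^ n"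
      "(z, x) \<in> nfa_step (brg G)"
    by auto
  obtain \<sigma> where \<sigma>: "fires (net G) (init G) \<sigma> (fst z)" "length (word G \<sigma>) = n"
    using Suc.IH[OF z(1)] by blast
  from z(2) obtain M M' t y e where s: "z = brg_state G M" "x = brg_state G M'"
      "basis_step G M t y M'" "label G t = Some e"
    unfolding nfa_step_brg by blast
  obtain \<rho> where "set \<rho> \<subseteq> unobs G" "fires (net G) M (\<rho> @ [t]) M'"
    using basis_step_fires[OF pn s(3)] by blast
  then show ?case
    using \<sigma> s by (intro exI[of _ "\<sigma> @ \<rho> @ [t]"])
      (auto simp: fires_append[of _ _ \<sigma>] word_append word_Cons word_unobs)
qed

lemma basis_marking_path:
  assumes "M \<in> basis_markings G"
  shows "(brg_state G (init G), brg_state G M) \<in> (nfa_step (brg G))\<^sup>*"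
  using assms
proof (induction rule: basis_markings.induct)
  case (step M t y M')
  then show ?case using basis_step_nfa_step rtrancl.rtrancl_into_rtrancl by metis
qed simp

lemma basis_markings_reachable:
  assumes "petri_net (net G)"
  shows "basis_markings G \<subseteq> reachable (net G) (init G)"
proof
  fix M assume "M \<in> basis_markings G"
  then obtain n where "(brg_state G (init G), brg_state G M) \<in> nfa_step (brg G) ^^ n"
    using basis_marking_path rtrancl_imp_relpow by metis
  then show "M \<in> reachable (net G) (init G)"
    using basis_path_fires[OF assms] by (fastforce simp: reachable_def)
qed


section \<open>Cycles in automata\<close>

lemma nfa_cycle_power:
  assumes "nfa_cycle B xs es" "i < length xs"
  shows "(xs ! i, xs ! ((i + m) mod length xs)) \<in> nfa_step B ^^ m"
proof (induction m)
  case 0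
  then show ?case using assms by simp
next
  case (Suc m)
  let ?j = "(i + m) mod length xs"
  have "?j < length xs" using assms(2) by (intro mod_less_divisor) linarith
  then have "(xs ! ?j, xs ! (Suc ?j mod length xs)) \<in> nfa_step B"
    using assms(1) unfolding nfa_cycle_def nfa_step_def by blast
  with Suc show ?case by (auto simp: mod_Suc_eq)
qed

text \<open>Going \<open>K\<close> times around the cycle before leaving it for \<open>x\<close>
  makes the path as long as desired.\<close>

lemma reachable_from_cycle_long_path:
  assumes "reachable_from_cycle B x"
    and "\<forall>z\<in>Domain (nfa_step B). (a, z) \<in> (nfa_step B)\<^sup>*"
  shows "\<exists>n\<ge>K. (a, x) \<in> nfa_step B ^^ n"
proof -
  obtain xs es z where z: "nfa_cycle B xs es" "z \<in> set xs" "(z, x) \<in> (nfa_step B)\<^sup>*"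
    using assms(1) unfolding reachable_from_cycle_def by blast
  obtain i where i: "i < length xs" "z = xs ! i"
    using z(2) by (metis in_set_conv_nth)
  \<comment> \<open>The outgoing cycle edge puts \<open>z\<close> into the domain, which is what the
    reachability assumption asks for.\<close>
  then have "(z, xs ! (Suc i mod length xs)) \<in> nfa_step B"
    using z(1) unfolding nfa_cycle_def nfa_step_def by blast
  then obtain m where "(a, z) \<in> nfa_step B ^^ m"
    using assms(2) rtrancl_imp_relpow by (metis DomainI)
  moreover have "(z, z) \<in> nfa_step B ^^ (K * length xs)"
    using nfa_cycle_power[OF z(1) i(1), of "K * length xs"] i by simp
  moreover obtain k where "(z, x) \<in> nfa_step B ^^ k"
    using z(3) rtrancl_imp_relpow by metis
  ultimately have "(a, x) \<in> nfa_step B ^^ (m + (K * length xs + k))"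
    by (auto simp: relpow_add)
  moreover have "K \<le> K * length xs"
    using i(1) by (cases "length xs") auto
  ultimately show ?thesis
    by (metis le_add1 le_add2 order_trans)
qed

text \<open>A repetition of least distance \<open>d\<close> has pairwise distinct states in between,
  as two equal ones would repeat at a smaller distance. It is therefore a cycle in the strict
  sense.\<close>

lemma repetition_nfa_cycle:
  assumes steps: "\<And>i. i < n \<Longrightarrow> (f i, f (Suc i)) \<in> nfa_step B"
    and rep: "i < j" "j \<le> n" "f i = f j"
  shows "\<exists>xs es k. nfa_cycle B xs es \<and> k \<le> n \<and> f k \<in> set xs"
proof -
  let ?P = "\<lambda>d. d > 0 \<and> (\<exists>i. i + d \<le> n \<and> f i = f (i + d))"
  have "?P (j - i)" using rep by (intro conjI exI[of _ i]) auto
  then obtain d where "?P d" and least: "\<And>d'. ?P d' \<Longrightarrow> d \<le> d'"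
    using ex_has_least_nat[of ?P "j - i" "\<lambda>d. d"] by blast
  then obtain k where d: "d > 0" "k + d \<le> n" "f k = f (k + d)" by blast
  let ?xs = "map (\<lambda>i. f (k + i)) [0..<d]"
  have neq: "f (k + a) \<noteq> f (k + b)" if "a < b" "b < d" for a b
  proof
    assume "f (k + a) = f (k + b)"
    then have "?P (b - a)"
      using that d by (intro conjI exI[of _ "k + a"]) auto
    from least[OF this] show False using that by linarith
  qed
  have "distinct ?xs"
    unfolding distinct_conv_nth
    by (auto, metis neq nat_neq_iff)
  moreover obtain e where e: "(f i, e i, f (Suc i)) \<in> nfa_edges B" if "i < n" for i
    using steps unfolding nfa_step_def by simp metis
  have "(?xs ! i, map (\<lambda>i. e (k + i)) [0..<d] ! i, ?xs ! (Suc i mod d)) \<in> nfa_edges B"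
    if "i < d" for i
  proof (cases "Suc i = d")
    \<comment> \<open>The last edge ends in \<open>f (k + d)\<close>, which is the first state
      \<open>f k\<close>.\<close>
    case True
    then show ?thesis using that e[of "k + i"] d by auto
  next
    case False
    then show ?thesis using that e[of "k + i"] d by auto
  qed
  ultimately have "nfa_cycle B ?xs (map (\<lambda>i. e (k + i)) [0..<d])"
    using d by (simp add: nfa_cycle_def)
  moreover have "f k \<in> set ?xs"
    using d(1) by (force intro: image_eqI[of _ _ 0])
  ultimately show ?thesis using d by (metis le_add1 order_trans)
qed

text \<open>A path with \<open>n\<close> edges visits \<open>n + 1\<close> positions, so
  \<open>card X \<le> n\<close> already forces a repetition; the rest of the path leads from the
  resulting cycle to \<open>x\<close>.\<close>

lemma long_path_reachable_from_cycle:
  assumes "finite X" "a \<in> X" "nfa_step B \<subseteq> X \<times> X" "card X \<le> n" "(a, x) \<in> nfa_step B ^^ n"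
  shows "reachable_from_cycle B x"
proof -
  obtain f where f: "f 0 = a" "f n = x" "\<And>i. i < n \<Longrightarrow> (f i, f (Suc i)) \<in> nfa_step B"
    using assms(5) unfolding relpow_fun_conv by blast
  have "f i \<in> X" if "i \<le> n" for i
  proof (cases i)
    case 0
    then show ?thesis using f(1) assms(2) by simp
  next
    case (Suc j)
    then show ?thesis using f(3)[of j] that assms(3) by auto
  qed
  then have "f ` {..n} \<subseteq> X" by auto
  then have "card (f ` {..n}) \<le> card X"
    by (rule card_mono[OF assms(1)])
  then have "card (f ` {..n}) < card {..n}"
    using assms(4) by simp
  then have "\<not> inj_on f {..n}" by (rule pigeonhole)
  then obtain i j where "i < j" "j \<le> n" "f i = f j"
    unfolding inj_on_def by (metis atMost_iff nat_neq_iff)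
  then obtain xs es k where k: "nfa_cycle B xs es" "k \<le> n" "f k \<in> set xs"
    using repetition_nfa_cycle[of n f B] f(3) by metis
  have "(f k, f (k + d)) \<in> (nfa_step B)\<^sup>*" if "k + d \<le> n" for d
    using that
  proof (induction d)
    case (Suc d)
    then show ?case using f(3)[of "k + d"] by (auto intro: rtrancl.rtrancl_into_rtrancl)
  qed simp
  from this[of "n - k"] have "(f k, x) \<in> (nfa_step B)\<^sup>*"
    using k f by simp
  with k show ?thesis unfolding reachable_from_cycle_def by blast
qed


section \<open>The verifier net\<close>

lemma verifier_simps [simp]:
  "places (net (verifier G)) = places (net G) <+> places (net G)"
  "transitions (net (verifier G)) = verifier_obs G \<union> verifier_unobs G"
  "Pre (net (verifier G)) = verifier_arcs (Pre (net G))"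
  "Post (net (verifier G)) = verifier_arcs (Post (net G))"
  "init (verifier G) = case_sum (init G) (init G)"
  "label (verifier G) = verifier_label G"
  by (simp_all add: verifier_def)

lemma unobs_verifier: "unobs (verifier G) = verifier_unobs G"
  by (auto simp: unobs_def verifier_label_def verifier_obs_def verifier_unobs_def obs_def)

lemma petri_net_verifier:
  assumes "petri_net (net G)"
  shows "petri_net (net (verifier G))"
proof -
  have fin: "finite (obs G)" "finite (unobs G)"
    using assms by (auto simp: petri_net_def obs_def unobs_def)
  have "verifier_obs G \<subseteq> (Some ` obs G) \<times> (Some ` obs G)"
    by (auto simp: verifier_obs_def)
  then have "finite (verifier_obs G)"
    using fin by (meson finite_SigmaI finite_imageI finite_subset)
  moreover have "finite (verifier_unobs G)"
    using fin by (simp add: verifier_unobs_def)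
  ultimately show ?thesis
    using assms
    by (auto simp: petri_net_def verifier_arcs_def verifier_obs_def verifier_unobs_def
        obs_def unobs_def split: sum.splits)
qed

lemma acyclic_verifier:
  assumes "acyclic_net (unobs_subnet G)"
  shows "acyclic_net (unobs_subnet (verifier G))"
proof -
  \<comment> \<open>\<open>h\<close> folds both copies onto the original net. An unobservable
    verifier transition has exactly one nonempty component, which \<open>h\<close> selects; arcs go
    to arcs, so a cycle would be mapped to a cycle.\<close>
  define h :: "('a + 'a) + ('b option \<times> 'b option) \<Rightarrow> 'a + 'b" where
    "h = case_sum (\<lambda>q. Inl (case_sum id id q))
      (\<lambda>\<tau>. Inr (case fst \<tau> of None \<Rightarrow> the (snd \<tau>) | Some t \<Rightarrow> t))"
  have step: "(h a, h b) \<in> flow (unobs_subnet G)"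
    if "(a, b) \<in> flow (unobs_subnet (verifier G))" for a b
    using that
    by (auto simp: flow_def unobs_subnet_def unobs_verifier verifier_unobs_def verifier_arcs_def
        h_def)
  have "(h a, h b) \<in> (flow (unobs_subnet G))\<^sup>+"
    if "(a, b) \<in> (flow (unobs_subnet (verifier G)))\<^sup>+" for a b
    using that
    by (induction rule: trancl_induct) (auto dest: step intro: trancl_into_trancl)
  then show ?thesis
    using assms unfolding acyclic_net_def acyclic_def by blast
qed

lemma enabled_verifier:
  "enabled (net (verifier G)) (case_sum A B) \<tau> \<longleftrightarrow> \<tau> \<in> verifier_obs G \<union> verifier_unobs G \<and>
    (\<forall>t. fst \<tau> = Some t \<longrightarrow> enabled (net G) A t) \<and> (\<forall>t. snd \<tau> = Some t \<longrightarrow> enabled (net G) B t)"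
  by (auto simp: enabled_def verifier_arcs_def verifier_obs_def verifier_unobs_def
      obs_def unobs_def Plus_def ball_Un)

lemma fire_verifier:
  "fire (net (verifier G)) (case_sum A B) \<tau> =
    case_sum (case fst \<tau> of None \<Rightarrow> A | Some t \<Rightarrow> fire (net G) A t)
             (case snd \<tau> of None \<Rightarrow> B | Some t \<Rightarrow> fire (net G) B t)"
  by (rule ext) (auto simp: fire_def verifier_arcs_def split: sum.split option.split)

lemma fires_verifierD:
  assumes "fires (net (verifier G)) (case_sum A B) \<sigma> M"
  shows "\<exists>A' B' \<sigma>1 \<sigma>2. M = case_sum A' B' \<and> fires (net G) A \<sigma>1 A' \<and> fires (net G) B \<sigma>2 B' \<and>
    word G \<sigma>1 = word (verifier G) \<sigma> \<and> word G \<sigma>2 = word (verifier G) \<sigma>"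
  using assms
proof (induction \<sigma> arbitrary: A B)
  case Nil
  then show ?case by (intro exI[of _ A] exI[of _ B] exI[of _ "[]"]) simp
next
  case (Cons \<tau> \<sigma>)
  then have en: "enabled (net (verifier G)) (case_sum A B) \<tau>" by simp
  let ?A = "case fst \<tau> of None \<Rightarrow> A | Some t \<Rightarrow> fire (net G) A t"
  let ?B = "case snd \<tau> of None \<Rightarrow> B | Some t \<Rightarrow> fire (net G) B t"
  obtain A' B' \<sigma>1 \<sigma>2 where IH: "M = case_sum A' B'" "fires (net G) ?A \<sigma>1 A'"
      "fires (net G) ?B \<sigma>2 B'"
      "word G \<sigma>1 = word (verifier G) \<sigma>" "word G \<sigma>2 = word (verifier G) \<sigma>"
    using Cons.IH[of ?A ?B] Cons.prems by (auto simp: fire_verifier)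
  let ?s1 = "(case fst \<tau> of None \<Rightarrow> [] | Some t \<Rightarrow> [t]) @ \<sigma>1"
  let ?s2 = "(case snd \<tau> of None \<Rightarrow> [] | Some t \<Rightarrow> [t]) @ \<sigma>2"
  have "fires (net G) A ?s1 A'" "fires (net G) B ?s2 B'"
    using en IH by (auto simp: enabled_verifier split: option.splits)
  moreover have "word G ?s1 = word (verifier G) (\<tau> # \<sigma>)" "word G ?s2 = word (verifier G) (\<tau> # \<sigma>)"
    using en IH
    by (auto simp: enabled_verifier word_Cons verifier_label_def verifier_obs_def
        verifier_unobs_def obs_def unobs_def)
  ultimately show ?case using IH(1) by blast
qed

text \<open>The two sequences are interleaved: leading unobservable transitions are fired alone, and
  once neither sequence starts with one, equality of the words lets the two leading observable
  transitions fire as a pair.\<close>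

lemma fires_verifierI:
  assumes "fires (net G) A \<sigma>1 A'" "fires (net G) B \<sigma>2 B'" "word G \<sigma>1 = word G \<sigma>2"
  shows "\<exists>\<sigma>. fires (net (verifier G)) (case_sum A B) \<sigma> (case_sum A' B') \<and>
    word (verifier G) \<sigma> = word G \<sigma>1"
  using assms
proof (induction "length \<sigma>1 + length \<sigma>2" arbitrary: \<sigma>1 \<sigma>2 A B rule: less_induct)
  case less
  \<comment> \<open>Common part of the three cases: \<open>\<tau>\<close> consumes the head of one
    or both sequences, and the induction hypothesis handles the remainders.\<close>
  have step: ?case
    if "\<tau> \<in> verifier_obs G \<union> verifier_unobs G"
      and "\<sigma>1 = (case fst \<tau> of None \<Rightarrow> [] | Some t \<Rightarrow> [t]) @ \<rho>1"
      and "\<sigma>2 = (case snd \<tau> of None \<Rightarrow> [] | Some t \<Rightarrow> [t]) @ \<rho>2" for \<tau> \<rho>1 \<rho>2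
  proof -
    let ?A = "case fst \<tau> of None \<Rightarrow> A | Some t \<Rightarrow> fire (net G) A t"
    let ?B = "case snd \<tau> of None \<Rightarrow> B | Some t \<Rightarrow> fire (net G) B t"
    have "length \<rho>1 + length \<rho>2 < length \<sigma>1 + length \<sigma>2"
      using that by (auto simp: verifier_obs_def verifier_unobs_def)
    moreover have "fires (net G) ?A \<rho>1 A'" "fires (net G) ?B \<rho>2 B'"
      using less.prems that by (auto split: option.splits)
    moreover have "word G \<rho>1 = word G \<rho>2"
      using less.prems that
      by (auto simp: word_Cons verifier_obs_def verifier_unobs_def obs_def unobs_def)
    ultimately obtain \<sigma> where \<sigma>:
      "fires (net (verifier G)) (case_sum ?A ?B) \<sigma> (case_sum A' B')"
      "word (verifier G) \<sigma> = word G \<rho>1"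
      using less.hyps by blast
    have "enabled (net (verifier G)) (case_sum A B) \<tau>"
      using less.prems that by (auto simp: enabled_verifier)
    then have "fires (net (verifier G)) (case_sum A B) (\<tau> # \<sigma>) (case_sum A' B')"
      using \<sigma>(1) by (simp add: fire_verifier)
    moreover have "word (verifier G) (\<tau> # \<sigma>) = word G \<sigma>1"
      using \<sigma>(2) that
      by (auto simp: word_Cons verifier_label_def verifier_obs_def verifier_unobs_def
          obs_def unobs_def)
    ultimately show ?thesis by blast
  qed
  show ?case
  proof (cases "\<exists>t \<rho>. \<sigma>1 = t # \<rho> \<and> label G t = None")
    case True
    then obtain t \<rho> where t: "\<sigma>1 = t # \<rho>" "label G t = None" by blast
    then have "t \<in> unobs G"
      using less.prems(1) by (auto simp: unobs_def enabled_def)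
    then show ?thesis
      using t by (intro step[of "(Some t, None)" \<rho> \<sigma>2]) (auto simp: verifier_unobs_def)
  next
    case 1: False
    show ?thesis
    proof (cases "\<exists>t \<rho>. \<sigma>2 = t # \<rho> \<and> label G t = None")
      case True
      then obtain t \<rho> where t: "\<sigma>2 = t # \<rho>" "label G t = None" by blast
      then have "t \<in> unobs G"
        using less.prems(2) by (auto simp: unobs_def enabled_def)
      then show ?thesis
        using t by (intro step[of "(None, Some t)" \<sigma>1 \<rho>]) (auto simp: verifier_unobs_def)
    next
      case 2: False
      show ?thesis
      proof (cases \<sigma>1)
        case Nil
        then have "\<sigma>2 = []"
          using 2 less.prems(3) by (cases \<sigma>2) (auto simp: word_Cons)
        then show ?thesis
          using Nil less.prems by (intro exI[of _ "[]"]) simp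
      next
        case (Cons t \<rho>1)
        with 1 obtain e where e: "label G t = Some e" by auto
        then obtain s \<rho>2 where s: "\<sigma>2 = s # \<rho>2"
          using less.prems(3) Cons by (cases \<sigma>2) (auto simp: word_Cons)
        with 2 have "label G s = Some e"
          using less.prems(3) Cons e by (auto simp: word_Cons)
        then have "(Some t, Some s) \<in> verifier_obs G"
          using less.prems Cons s e by (auto simp: verifier_obs_def obs_def enabled_def)
        then show ?thesis
          using Cons s by (intro step[of "(Some t, Some s)" \<rho>1 \<rho>2]) auto
      qed
    qed
  qed
qed

lemma finite_reachable:
  assumes "labeled_petri_net G" "bounded_net (net G) (init G)"
  shows "finite (reachable (net G) (init G))"
proof -
  have pn: "petri_net (net G)" using assms(1) by (simp add: labeled_petri_net_def)
  obtain k where k: "\<forall>M\<in>reachable (net G) (init G). \<forall>p\<in>places (net G). M p \<le> k"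
    using assms(2) by (auto simp: bounded_net_def)
  \<comment> \<open>Markings are functions on the whole place type, so a finite count needs them to
    stay zero off the places.\<close>
  have off: "M' p = M p" if "fires (net G) M \<sigma> M'" "p \<notin> places (net G)" for M \<sigma> M' p
    using that(1)
  proof (induction \<sigma> arbitrary: M)
    case (Cons t \<sigma>)
    then have "fire (net G) M t p = M p"
      using pn that(2) by (auto simp: fire_def enabled_def petri_net_def)
    with Cons.IH[of "fire (net G) M t"] Cons.prems show ?case by simp
  qed simp
  have "reachable (net G) (init G) \<subseteq>
      {M. \<forall>p. (p \<in> places (net G) \<longrightarrow> M p \<in> {..k}) \<and> (p \<notin> places (net G) \<longrightarrow> M p = 0)}"
    using k off assms(1) by (fastforce simp: reachable_def labeled_petri_net_def)
  moreover have "finite \<dots>"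
    using pn by (intro finite_set_of_finite_funs) (auto simp: petri_net_def)
  ultimately show ?thesis by (rule finite_subset)
qed

lemma finite_basis_markings_verifier:
  assumes "labeled_petri_net G" "bounded_net (net G) (init G)"
  shows "finite (basis_markings (verifier G))"
proof -
  let ?R = "reachable (net G) (init G)"
  have pn: "petri_net (net G)" using assms(1) by (simp add: labeled_petri_net_def)
  have "basis_markings (verifier G) \<subseteq> (\<lambda>(A, B). case_sum A B) ` (?R \<times> ?R)"
    using basis_markings_reachable[OF petri_net_verifier[OF pn]]
    by (fastforce simp: reachable_def dest!: fires_verifierD)
  moreover have "finite ((\<lambda>(A, B). case_sum A B) ` (?R \<times> ?R))"
    using finite_reachable[OF assms] by simp
  ultimately show ?thesis by (rule finite_subset)
qed


section \<open>Strong detectability\<close>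

text \<open>Strong detectability constrains only prefixes of infinite runs. Deadlock-freeness makes
  every firable sequence such a prefix, by choosing an enabled transition again and again.\<close>

lemma firable_extends_to_infinite:
  assumes dl: "deadlock_free (net G) (init G)" and "\<sigma> \<in> firable (net G) (init G)"
  shows "\<exists>\<omega>\<in>infinite_firable G. stake (length \<sigma>) \<omega> = \<sigma>"
proof -
  obtain M where M: "fires (net G) (init G) \<sigma> M"
    using assms(2) by (auto simp: firable_def)
  define nxt where "nxt M = (SOME t. enabled (net G) M t)" for M
  define g where "g M = fire (net G) M (nxt M)" for M
  have nxt: "enabled (net G) M' (nxt M')" if "fires (net G) (init G) \<rho> M'" for \<rho> M'
  proof -
    have "\<exists>t. enabled (net G) M' t"
      using dl that by (auto simp: deadlock_free_def reachable_def)
    then show ?thesis unfolding nxt_def by (rule someI_ex)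
  qed
  have inf: "\<exists>M''. fires (net G) M' (stake n (smap nxt (siterate g M'))) M''"
    if "fires (net G) (init G) \<rho> M'" for n \<rho> M'
    using that
  proof (induction n arbitrary: \<rho> M')
    case (Suc n)
    have "fires (net G) (init G) (\<rho> @ [nxt M']) (g M')"
      using Suc.prems nxt[OF Suc.prems] by (auto simp: fires_append g_def)
    from Suc.IH[OF this] obtain M'' where
      "fires (net G) (g M') (stake n (smap nxt (siterate g (g M')))) M''" by blast
    moreover have "stake (Suc n) (smap nxt (siterate g M'))
        = nxt M' # stake n (smap nxt (siterate g (g M')))"
      by (simp only: stake.simps(2) stream.map_sel siterate.simps)
    ultimately show ?case
      using nxt[OF Suc.prems] by (metis fires.simps(2) g_def)
  qed auto
  let ?\<omega> = "\<sigma> @- smap nxt (siterate g M)"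
  have "stake n ?\<omega> \<in> firable (net G) (init G)" for n
  proof -
    have "\<exists>M''. fires (net G) (init G) (\<sigma> @ stake n (smap nxt (siterate g M))) M''"
      unfolding fires_append using M inf[OF M, of n] by blast
    \<comment> \<open>The prefix of length \<open>length \<sigma> + n\<close> contains all of
      \<open>\<sigma>\<close>, and the wanted prefix of length \<open>n\<close> is cut from it; this
      avoids comparing \<open>n\<close> with \<open>length \<sigma>\<close>.\<close>
    moreover have "\<sigma> @ stake n (smap nxt (siterate g M)) = stake (length \<sigma> + n) ?\<omega>"
      by (simp add: stake_shift)
    moreover have "stake (length \<sigma> + n) ?\<omega> = stake n ?\<omega> @ stake (length \<sigma>) (sdrop n ?\<omega>)"
      by (metis add.commute stake_add)
    ultimately have "\<exists>M''. fires (net G) (init G) (stake n ?\<omega> @ stake (length \<sigma>) (sdrop n ?\<omega>)) M''"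
      by (simp only:)
    then show ?thesis unfolding firable_def fires_append by blast
  qed
  then have "?\<omega> \<in> infinite_firable G" by (simp add: infinite_firable_def)
  moreover have "stake (length \<sigma>) ?\<omega> = \<sigma>" by (simp add: stake_shift)
  ultimately show ?thesis by blast
qed

lemma consistent_markings_iff:
  "M \<in> consistent_markings G w \<longleftrightarrow> (\<exists>\<sigma>. fires (net G) (init G) \<sigma> M \<and> word G \<sigma> = w)"
  by (auto simp: consistent_markings_def firable_def)

lemma strongly_detectable_unique:
  assumes "strongly_detectable G" "deadlock_free (net G) (init G)"
  obtains K where "\<And>w A B. length w \<ge> K \<Longrightarrow> A \<in> consistent_markings G w \<Longrightarrow>
    B \<in> consistent_markings G w \<Longrightarrow> A = B"
proof -
  obtain K where K: "\<And>\<omega> n. \<omega> \<in> infinite_firable G \<Longrightarrow> length (word G (stake n \<omega>)) \<ge> K \<Longrightarrow>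
      card (consistent_markings G (word G (stake n \<omega>))) = 1"
    using assms(1) by (auto simp: strongly_detectable_def Let_def)
  show thesis
  proof (rule that)
    fix w A B
    assume w: "length w \<ge> K" "A \<in> consistent_markings G w" "B \<in> consistent_markings G w"
    then obtain \<sigma> where \<sigma>: "\<sigma> \<in> firable (net G) (init G)" "word G \<sigma> = w"
      by (auto simp: consistent_markings_def)
    obtain \<omega> where "\<omega> \<in> infinite_firable G" "stake (length \<sigma>) \<omega> = \<sigma>"
      using firable_extends_to_infinite[OF assms(2) \<sigma>(1)] by blast
    then have "card (consistent_markings G w) = 1"
      using K[of \<omega> "length \<sigma>"] \<sigma> w by simp
    then show "A = B" using w by (auto simp: card_1_singleton_iff)
  qed
qed

lemma strongly_detectableI:
  assumes "\<And>w A B. length w \<ge> K \<Longrightarrow> A \<in> consistent_markings G w \<Longrightarrow>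
    B \<in> consistent_markings G w \<Longrightarrow> A = B"
  shows "strongly_detectable G"
  unfolding strongly_detectable_def Let_def
proof (intro exI[of _ K] ballI allI impI)
  fix \<omega> n
  assume \<omega>: "\<omega> \<in> infinite_firable G" and len: "K \<le> length (word G (stake n \<omega>))"
  \<comment> \<open>Uniqueness alone would also allow the empty set; the marking reached by the
    prefix itself excludes it.\<close>
  obtain M where "fires (net G) (init G) (stake n \<omega>) M"
    using \<omega> unfolding infinite_firable_def firable_def by blast
  then have "M \<in> consistent_markings G (word G (stake n \<omega>))"
    unfolding consistent_markings_iff by blast
  then have "consistent_markings G (word G (stake n \<omega>)) = {M}"
    using assms[OF len] by blast
  then show "card (consistent_markings G (word G (stake n \<omega>))) = 1" by simp
qed

text \<open>A transition that is not isolated has an arc, and without self-loops this arc cannot be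
  cancelled by an opposite one at the same place.\<close>

lemma fire_unobs_neq:
  assumes pn: "petri_net (net G)" and ac: "acyclic_net (unobs_subnet G)"
    and t: "t \<in> unobs G" "\<not> isolated_transition (net G) t" "enabled (net G) M t"
  shows "fire (net G) M t \<noteq> M"
proof -
  obtain p where p: "p \<in> places (net G)" "Pre (net G) p t \<noteq> 0 \<or> Post (net G) p t \<noteq> 0"
    using t(2) by (auto simp: isolated_transition_def)
  then have "incidence (net G) p t \<noteq> 0"
    using unobs_no_self_loop[OF ac t(1) p(1)] by (auto simp: incidence_def)
  then have "fire (net G) M t p \<noteq> M p"
    using fire_eq[OF pn t(3), of p] by auto
  then show ?thesis by auto
qed

theorem mainTheorem1:
  fixes G :: "('p, 't, 'e) lpn"
  assumes "labeled_petri_net G"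
    and "bounded_net (net G) (init G)"
    and "deadlock_free (net G) (init G)"
    and "acyclic_net (unobs_subnet G)"
    and no_isolated: "\<And>t. t \<in> unobs G \<Longrightarrow> \<not> isolated_transition (net G) t"
  shows "strongly_detectable G \<longleftrightarrow>
    (\<forall>Mb. (Mb, alpha (verifier G) Mb) \<in> nfa_states (brg (verifier G)) \<and>
          reachable_from_cycle (brg (verifier G)) (Mb, alpha (verifier G) Mb) \<longrightarrow>
       alpha (verifier G) Mb = 0 \<and> (\<exists>Mb' Mb''. Mb = case_sum Mb' Mb'' \<and> Mb' = Mb''))"
    (is "_ \<longleftrightarrow> ?cond")
proof -
  let ?V = "verifier G"
  let ?B = "brg ?V"
  have pn: "petri_net (net G)" using assms(1) by (simp add: labeled_petri_net_def)
  note pnV = petri_net_verifier[OF pn] and acV = acyclic_verifier[OF assms(4)]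
  show ?thesis
  proof
    assume "strongly_detectable G"
    then obtain K where K: "\<And>w A B. length w \<ge> K \<Longrightarrow> A \<in> consistent_markings G w \<Longrightarrow>
        B \<in> consistent_markings G w \<Longrightarrow> A = B"
      using strongly_detectable_unique assms(3) by blast
    show ?cond
    proof (intro allI impI, elim conjE)
      fix Mb
      assume cyc: "reachable_from_cycle ?B (brg_state ?V Mb)"
      have "\<forall>z\<in>Domain (nfa_step ?B). (brg_state ?V (init ?V), z) \<in> (nfa_step ?B)\<^sup>*"
      proof
        fix z assume "z \<in> Domain (nfa_step ?B)"
        then obtain M where "z = brg_state ?V M" "M \<in> basis_markings ?V"
          unfolding Domain_iff nfa_step_brg by blast
        then show "(brg_state ?V (init ?V), z) \<in> (nfa_step ?B)\<^sup>*"
          using basis_marking_path[of M ?V] by simp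
      qed
      from reachable_from_cycle_long_path[OF cyc this, where K = K] obtain n where n: "n \<ge> K"
          "(brg_state ?V (init ?V), brg_state ?V Mb) \<in> nfa_step ?B ^^ n"
        by blast
      obtain \<sigma> where "fires (net ?V) (init ?V) \<sigma> Mb" and len: "length (word ?V \<sigma>) = n"
        using basis_path_fires[OF pnV n(2)] by auto
      then obtain A B \<sigma>1 \<sigma>2 where AB: "Mb = case_sum A B"
          "fires (net G) (init G) \<sigma>1 A" "fires (net G) (init G) \<sigma>2 B"
          "word G \<sigma>1 = word ?V \<sigma>" "word G \<sigma>2 = word ?V \<sigma>"
        using fires_verifierD[of G "init G" "init G" \<sigma> Mb] by auto
      define w where "w = word ?V \<sigma>"
      have w: "length w \<ge> K" using len n(1) by (simp add: w_def)
      have mem: "A \<in> consistent_markings G w" "B \<in> consistent_markings G w"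
        using AB by (auto simp: consistent_markings_iff w_def)
      \<comment> \<open>Firing \<open>t\<close> would give a second marking consistent with the same
        long word \<open>w\<close>, contradicting uniqueness.\<close>
      have stuck: "\<not> enabled (net G) M t"
        if M: "M \<in> consistent_markings G w" and t: "t \<in> unobs G" for M t
      proof
        assume en: "enabled (net G) M t"
        obtain \<rho> where "fires (net G) (init G) \<rho> M" "word G \<rho> = w"
          using M by (auto simp: consistent_markings_iff)
        then have "fire (net G) M t \<in> consistent_markings G w"
          unfolding consistent_markings_iff using en t
          by (intro exI[of _ "\<rho> @ [t]"]) (auto simp: fires_append word_append word_unobs)
        then show False
          using K[OF w _ M] fire_unobs_neq[OF pn assms(4) t no_isolated[OF t] en] by blast
      qed
      have "\<not> enabled (net ?V) Mb \<tau>" if "\<tau> \<in> unobs ?V" for \<tau>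
        using that stuck mem unfolding AB(1)
        by (auto simp: enabled_verifier unobs_verifier verifier_unobs_def)
      then have "alpha ?V Mb = 0"
        using alpha_eq_1_iff[OF pnV acV, of Mb] alpha_cases[of ?V Mb] by auto
      with K[OF w mem] AB(1)
      show "alpha ?V Mb = 0 \<and> (\<exists>Mb' Mb''. Mb = case_sum Mb' Mb'' \<and> Mb' = Mb'')" by blast
    qed
  next
    assume cond: ?cond
    define X where "X = brg_state ?V ` basis_markings ?V"
    have "finite X"
      using finite_basis_markings_verifier[OF assms(1,2)] by (simp add: X_def)
    have "brg_state ?V (init ?V) \<in> X"
      unfolding X_def by (intro imageI basis_markings.initial)
    have "nfa_step ?B \<subseteq> X \<times> X"
      unfolding X_def by (rule subrelI, unfold nfa_step_brg) (blast intro: basis_markings.step)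
    show "strongly_detectable G"
    \<comment> \<open>A word of this length yields a path at least as long as the number of states,
      hence one ending in a state reachable from a cycle.\<close>
    proof (rule strongly_detectableI[where K = "card X"])
      fix w A B
      assume len: "length w \<ge> card X"
        and mem: "A \<in> consistent_markings G w" "B \<in> consistent_markings G w"
      from mem obtain \<sigma>1 \<sigma>2 where "fires (net G) (init G) \<sigma>1 A" "fires (net G) (init G) \<sigma>2 B"
          "word G \<sigma>1 = w" "word G \<sigma>2 = w"
        by (auto simp: consistent_markings_iff)
      then obtain \<sigma> where \<sigma>: "fires (net ?V) (init ?V) \<sigma> (case_sum A B)" "word ?V \<sigma> = w"
        using fires_verifierI[of G "init G" \<sigma>1 A "init G" \<sigma>2 B] by auto
      obtain Mb \<rho> where Mb: "Mb \<in> basis_markings ?V" "set \<rho> \<subseteq> unobs ?V"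
          "fires (net ?V) Mb \<rho> (case_sum A B)"
          "(brg_state ?V (init ?V), brg_state ?V Mb) \<in> nfa_step ?B ^^ length w"
        using fires_basis_path[OF pnV acV \<sigma>(1)] \<sigma>(2) by blast
      have "reachable_from_cycle ?B (brg_state ?V Mb)"
        by (rule long_path_reachable_from_cycle) fact+
      moreover have "brg_state ?V Mb \<in> nfa_states ?B"
        using Mb(1) by (auto simp: brg_def)
      ultimately obtain C where C: "alpha ?V Mb = 0" "Mb = case_sum C C"
        using cond by blast
      \<comment> \<open>The first transition of a nonempty \<open>\<rho>\<close> would be
        unobservable and enabled at \<open>Mb\<close>, against \<open>alpha ?V Mb = 0\<close>. Hence
        the pair of \<open>A\<close> and \<open>B\<close> is the basis marking \<open>Mb\<close>,
        whose blocks agree.\<close>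
      have "\<rho> = []"
      proof (cases \<rho>)
        case (Cons \<tau> \<rho>')
        then show ?thesis
          using alpha_eq_1_iff[OF pnV acV, of Mb] C(1) Mb(2,3) by auto
      qed
      then have eq: "case_sum A B = case_sum C C"
        using Mb(3) C(2) by simp
      have "A p = B p" for p
        using fun_cong[OF eq, of "Inl p"] fun_cong[OF eq, of "Inr p"] by simp
      then show "A = B" by auto
    qed
  qed
qed

end
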